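(* Let $\Phi\in\mathbb{R}^{Q\times N}$, let $J:\mathbb{R}^N\to\mathbb{R}$ be a finite-valued convex function, let $x_0\in\mathbb{R}^N$, $T=T_{x_0}$, $f_{x_0}\in\operatorname{ri}\partial J(x_0)$ and $y=\Phi x_0$. Assume that $\operatorname{Ker}(\Phi)\cap T=\{0\}$ and $\mathbf{IC}(x_0)<1$. Then $x_0$ is the unique solution of $$\min_{x\in\mathbb{R}^N}J(x)\quad\text{subject to}\quad\Phi x=y.$$
   Context: For a finite-valued convex $J$ on $\mathbb{R}^N$ and $x\in\mathbb{R}^N$: $\bar S_x$ is the affine hull of $\partial J(x)$; $e_x$ is the orthogonal projection of $0$ onto $\bar S_x$; $S_x=\bar S_x-e_x$ (a linear subspace); $T_x=S_x^\perp$ (the model subspace). For a subspace $V$, $P_V$ is the orthogonal projector and $\Phi_V=\Phi P_V$; $A^+$ is the Moore–Penrose pseudo-inverse and $A^{+,*}=(A^+)^*$. For a closed convex $C\ni0$, $\gamma_C(u)=\inf\{\lambda>0:u\in\lambda C\}$ ($\inf\emptyset=+\infty$). For $f_x\in\operatorname{ri}\partial J(x)$ the subdifferential gauge is $J_{f_x}^{x,\circ}=\gamma_{\partial J(x)-f_x}$. When $\operatorname{Ker}(\Phi)\cap T_x=\{0\}$, the irrepresentability criterion is $\mathbf{IC}(x)=J_{f_x}^{x,\circ}\big(\Phi_{S_x}^*\Phi_{T_x}^{+,*}e_x-P_{S_x}f_x\big)$. *)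

theory Defs
  imports "HOL-Analysis.Analysis"
begin

definition subdifferential :: "('a::real_inner \<Rightarrow> real) \<Rightarrow> 'a \<Rightarrow> 'a set" where
  "subdifferential J x = {g. \<forall>z. J z \<ge> J x + g \<bullet> (z - x)}"

text \<open>
  On a closed convex set \<open>closest_point\<close> is the orthogonal projection, both for affine
  subspaces (\<open>subdiff_proj\<close>) and for linear ones (\<open>proj_matrix\<close>).
\<close>

definition subdiff_affine :: "('a::euclidean_space \<Rightarrow> real) \<Rightarrow> 'a \<Rightarrow> 'a set" where
  "subdiff_affine J x = affine hull (subdifferential J x)"

definition subdiff_proj :: "('a::euclidean_space \<Rightarrow> real) \<Rightarrow> 'a \<Rightarrow> 'a" where
  "subdiff_proj J x = closest_point (subdiff_affine J x) 0"

definition subdiff_space :: "('a::euclidean_space \<Rightarrow> real) \<Rightarrow> 'a \<Rightarrow> 'a set" where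
  "subdiff_space J x = (\<lambda>v. v - subdiff_proj J x) ` subdiff_affine J x"

definition model_space :: "('a::euclidean_space \<Rightarrow> real) \<Rightarrow> 'a \<Rightarrow> 'a set" where
  "model_space J x = (subdiff_space J x)\<^sup>\<bottom>"

text \<open>Only meaningful for a linear subspace; see \<open>proj_matrix_works\<close> below.\<close>

definition proj_matrix :: "(real^'n) set \<Rightarrow> real^'n^'n" where
  "proj_matrix V = matrix (closest_point V)"

definition restr_matrix :: "real^'n^'q \<Rightarrow> (real^'n) set \<Rightarrow> real^'n^'q" where
  "restr_matrix \<Phi> V = \<Phi> ** proj_matrix V"

definition is_pinv :: "real^'n^'q \<Rightarrow> real^'q^'n \<Rightarrow> bool" where
  "is_pinv A X \<longleftrightarrow> A ** X ** A = A \<and> X ** A ** X = X \<and>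
     transpose (A ** X) = A ** X \<and> transpose (X ** A) = X ** A"

text \<open>The Moore--Penrose pseudo-inverse; \<open>ex1_is_pinv\<close> below shows that it is well defined.\<close>

definition pinv :: "real^'n^'q \<Rightarrow> real^'q^'n" where
  "pinv A = (THE X. is_pinv A X)"

text \<open>Extended-real valued, so that the infimum of the empty set is \<open>\<infinity>\<close>.\<close>

definition gauge_of :: "'a::real_vector set \<Rightarrow> 'a \<Rightarrow> ereal" where
  "gauge_of C u = Inf {ereal t | t. t > 0 \<and> u \<in> (\<lambda>c. t *\<^sub>R c) ` C}"

definition subdiff_gauge :: "('a::real_inner \<Rightarrow> real) \<Rightarrow> 'a \<Rightarrow> 'a \<Rightarrow> 'a \<Rightarrow> ereal" where
  "subdiff_gauge J x f = gauge_of ((\<lambda>g. g - f) ` subdifferential J x)"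

definition IC :: "real^'n^'q \<Rightarrow> (real^'n \<Rightarrow> real) \<Rightarrow> real^'n \<Rightarrow> real^'n \<Rightarrow> ereal" where
  "IC \<Phi> J x f =
     subdiff_gauge J x f
       (transpose (restr_matrix \<Phi> (subdiff_space J x)) *v
          (transpose (pinv (restr_matrix \<Phi> (model_space J x))) *v subdiff_proj J x)
        - proj_matrix (subdiff_space J x) *v f)"

lemma closest_point_decomp:
  fixes V :: "'a::euclidean_space set"
  assumes V: "subspace V" and y: "y \<in> V" and z: "\<And>v. v \<in> V \<Longrightarrow> v \<bullet> z = 0"
  shows "closest_point V (y + z) = y"
proof (rule closest_point_unique[symmetric])
  show "convex V" "closed V" "y \<in> V"
    using V y by (auto simp: subspace_imp_convex closed_subspace)
  show "\<forall>v\<in>V. dist (y + z) y \<le> dist (y + z) v"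
  proof
    fix v assume "v \<in> V"
    then have "(y - v) \<bullet> z = 0" using z V y by (simp add: subspace_diff)
    then have "(norm (y - v + z))\<^sup>2 = (norm (y - v))\<^sup>2 + (norm z)\<^sup>2"
      by (simp add: norm_add_Pythagorean orthogonal_def)
    then have "(norm z)\<^sup>2 \<le> (norm (y - v + z))\<^sup>2" by simp
    then have "norm z \<le> norm (y - v + z)" by (rule power2_le_imp_le) simp
    then show "dist (y + z) y \<le> dist (y + z) v" by (simp add: dist_norm algebra_simps)
  qed
qed

lemma closest_point_subspace:
  fixes V :: "'a::euclidean_space set"
  assumes V: "subspace V"
  shows "closest_point V x \<in> V" and "v \<in> V \<Longrightarrow> v \<bullet> (x - closest_point V x) = 0"
proof -
  obtain y z where yz: "y \<in> span V" "\<And>w. w \<in> span V \<Longrightarrow> orthogonal z w" "x = y + z"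
    using orthogonal_subspace_decomp_exists[of V x] by metis
  have sp: "span V = V" using V by (simp add: span_eq_iff)
  have c: "closest_point V x = y"
    unfolding yz(3) using yz sp V
    by (intro closest_point_decomp) (auto simp: orthogonal_def inner_commute)
  show "closest_point V x \<in> V" using c yz sp by simp
  show "v \<bullet> (x - closest_point V x) = 0" if "v \<in> V"
    using c yz sp that by (auto simp: orthogonal_def inner_commute)
qed

lemma linear_closest_point:
  fixes V :: "'a::euclidean_space set"
  assumes V: "subspace V"
  shows "linear (closest_point V)"
proof (rule linearI)
  note c = closest_point_subspace[OF V]
  fix a b :: 'a and r :: real
  have "closest_point V ((closest_point V a + closest_point V b)
          + ((a - closest_point V a) + (b - closest_point V b)))
        = closest_point V a + closest_point V b"
    by (rule closest_point_decomp[OF V]) (auto simp: c V subspace_add inner_add_right)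
  then show "closest_point V (a + b) = closest_point V a + closest_point V b"
    by (simp add: algebra_simps)
  have "closest_point V (r *\<^sub>R closest_point V a + r *\<^sub>R (a - closest_point V a))
        = r *\<^sub>R closest_point V a"
    by (rule closest_point_decomp[OF V]) (auto simp: c V subspace_scale)
  then show "closest_point V (r *\<^sub>R a) = r *\<^sub>R closest_point V a"
    by (simp add: algebra_simps)
qed

lemma proj_matrix_works:
  assumes "subspace V"
  shows "proj_matrix V *v x = closest_point V x"
  unfolding proj_matrix_def using linear_closest_point[OF assms]
  by (simp add: matrix_works)

lemma transpose_proj_matrix:
  fixes V :: "(real^'n) set"
  assumes V: "subspace V"
  shows "transpose (proj_matrix V) = proj_matrix V"
proof -
  note c = closest_point_subspace[OF V]
  have "(transpose (proj_matrix V) *v x) \<bullet> z = (proj_matrix V *v x) \<bullet> z" for x z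
  proof -
    have "closest_point V z \<bullet> (x - closest_point V x) = 0"
      and "closest_point V x \<bullet> (z - closest_point V z) = 0"
      using c by auto
    then have "x \<bullet> closest_point V z = closest_point V x \<bullet> z"
      by (simp add: inner_diff_right inner_commute)
    then show ?thesis
      by (simp add: dot_lmul_matrix transpose_matrix_vector proj_matrix_works[OF V])
  qed
  then have "transpose (proj_matrix V) *v x = proj_matrix V *v x" for x
    using vector_eq_rdot by blast
  then show ?thesis by (simp add: matrix_eq)
qed

lemma is_pinv_unique:
  assumes "is_pinv A X" "is_pinv A Y"
  shows "X = Y"
proof -
  note * = assms[unfolded is_pinv_def]
  have "A ** X = transpose (A ** X)" using * by simp
  also have "\<dots> = transpose (A ** Y ** A ** X)" using * by simp
  also have "\<dots> = transpose (A ** X) ** transpose (A ** Y)"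
    by (simp add: matrix_mul_assoc flip: matrix_transpose_mul)
  also have "\<dots> = A ** X ** A ** Y" using * by (simp add: matrix_mul_assoc)
  finally have AX: "A ** X = A ** Y" using * by simp
  have "X ** A = transpose (X ** A)" using * by simp
  also have "\<dots> = transpose (X ** (A ** Y ** A))" using * by simp
  also have "\<dots> = transpose (Y ** A) ** transpose (X ** A)"
    by (simp add: matrix_mul_assoc flip: matrix_transpose_mul)
  also have "\<dots> = Y ** (A ** X ** A)" using * by (metis matrix_mul_assoc)
  finally have XA: "X ** A = Y ** A" using * by simp
  have "X = X ** (A ** X)" using * by (simp add: matrix_mul_assoc)
  also have "\<dots> = Y ** A ** Y" by (simp add: AX XA matrix_mul_assoc)
  finally show ?thesis using * by simp
qed

lemma ex1_is_pinv: "\<exists>!X. is_pinv A X" for A :: "real^'n^'q"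
proof -
  define W where "W = {x. A *v x = 0}\<^sup>\<bottom>"
  define R where "R = range ((*v) A)"
  have W: "subspace W" unfolding W_def by (rule subspace_orthogonal_comp)
  have R: "subspace R" unfolding R_def by (simp add: linear_subspace_image)
  have K: "subspace {x. A *v x = 0}"
    by (auto simp: subspace_def matrix_vector_right_distrib matrix_vector_mult_scaleR)
  have AW: "A *v closest_point W x = A *v x" for x
  proof -
    have "v \<bullet> (x - closest_point W x) = 0" if "v \<in> W" for v
      using closest_point_subspace(2)[OF W that] .
    then have "x - closest_point W x \<in> W\<^sup>\<bottom>"
      by (simp add: orthogonal_comp_def orthogonal_def)
    then have "A *v (x - closest_point W x) = 0"
      unfolding W_def using orthogonal_comp_self[OF K] by blast
    then show ?thesis by (simp add: matrix_vector_mult_diff_distrib)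
  qed
  have inj: "inj_on ((*v) A) W"
  proof (rule inj_onI)
    fix x y assume xy: "x \<in> W" "y \<in> W" "A *v x = A *v y"
    then have "x - y \<in> W" "A *v (x - y) = 0"
      using W by (auto simp: subspace_diff matrix_vector_mult_diff_distrib)
    then have "(x - y) \<bullet> (x - y) = 0"
      unfolding W_def orthogonal_comp_def orthogonal_def by blast
    then show "x = y" by simp
  qed
  obtain g where g: "linear g" "\<And>w. w \<in> W \<Longrightarrow> g (A *v w) = w" "range g \<subseteq> W"
  proof -
    have "\<exists>g. range g \<subseteq> W \<and> linear g \<and> (\<forall>x\<in>W. g (A *v x) = x)"
      using linear_exists_left_inverse_on[OF matrix_vector_mul_linear W inj] by blast
    then show ?thesis using that by blast
  qed
  define X where "X = matrix g ** proj_matrix R"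
  have X: "X *v y = g (closest_point R y)" for y
    using g(1) by (simp add: X_def proj_matrix_works[OF R] matrix_works
        flip: matrix_vector_mul_assoc)
  have cR: "closest_point R (A *v x) = A *v x" for x
    by (rule closest_point_self) (simp add: R_def)
  have XA: "X *v (A *v x) = closest_point W x" for x
  proof -
    have "X *v (A *v x) = g (A *v closest_point W x)" by (simp add: X cR AW)
    then show ?thesis using g(2) closest_point_subspace(1)[OF W] by simp
  qed
  have AX: "A *v (X *v y) = closest_point R y" for y
  proof -
    obtain x where x: "closest_point R y = A *v x"
      using closest_point_subspace(1)[OF R, of y] by (auto simp: R_def)
    have "X *v y = X *v (A *v x)" by (simp add: X x cR)
    then show ?thesis by (simp add: XA AW x)
  qed
  have XA': "X ** A = proj_matrix W"
    by (simp add: matrix_eq XA proj_matrix_works[OF W] flip: matrix_vector_mul_assoc)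
  have AX': "A ** X = proj_matrix R"
    by (simp add: matrix_eq AX proj_matrix_works[OF R] flip: matrix_vector_mul_assoc)
  have "is_pinv A X"
    unfolding is_pinv_def
  proof (intro conjI)
    show "A ** X ** A = A"
      by (simp add: matrix_eq AX cR flip: matrix_vector_mul_assoc)
    have "X *v y \<in> W" for y using g(3) by (auto simp: X)
    then show "X ** A ** X = X"
      by (simp add: matrix_eq XA closest_point_self flip: matrix_vector_mul_assoc)
    show "transpose (A ** X) = A ** X" by (simp add: AX' transpose_proj_matrix[OF R])
    show "transpose (X ** A) = X ** A" by (simp add: XA' transpose_proj_matrix[OF W])
  qed
  then show ?thesis using is_pinv_unique by blast
qed

end

theory Submission
  imports Defs
begin

text \<open>
  The vector \<open>\<alpha> = \<Phi>\<^sup>T q\<close> with \<open>q = (\<Phi>\<^sub>T\<^sup>+)\<^sup>T e\<close> is a dual certificate. By construction it is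
  orthogonal to the kernel of \<open>\<Phi>\<close>, and injectivity of \<open>\<Phi>\<close> on \<open>T\<close> makes its component in
  \<open>T\<close> equal to \<open>e\<close> (\<open>transpose_restr_pinv\<close>). As \<open>f\<close> has the same component in \<open>T\<close>, the
  argument of the gauge in \<open>IC\<close> is just \<open>\<alpha> - f\<close>. Hence \<open>IC < 1\<close> says that \<open>\<alpha>\<close> arises from a
  point of the subdifferential by shrinking strictly towards the relative interior point \<open>f\<close>,
  so \<open>\<alpha>\<close> lies in the relative interior itself (\<open>gauge_less_1_rel_interior\<close>).

  Let now \<open>h\<close> be in the kernel of \<open>\<Phi>\<close> with \<open>J (x0 + h) \<le> J x0\<close>. All subgradients \<open>g\<close> at \<open>x0\<close>
  satisfy \<open>g \<bullet> h \<le> 0 = \<alpha> \<bullet> h\<close>, so the linear functional \<open>\<lambda>g. g \<bullet> h\<close> attains its maximum over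
  the subdifferential at a relative interior point and must be constant there
  (\<open>inner_le_rel_interior_const\<close>). Thus \<open>h\<close> is orthogonal to the direction space \<open>S\<close> of the
  subdifferential, that is \<open>h \<in> T\<close>, and \<open>h = 0\<close> because \<open>\<Phi>\<close> is injective on \<open>T\<close>.
\<close>

lemma convex_subdifferential: "convex (subdifferential J x)"
proof -
  have "subdifferential J x = (\<Inter>z. {g. (z - x) \<bullet> g \<le> J z - J x})"
    by (auto simp: subdifferential_def inner_commute algebra_simps)
  then show ?thesis
    by (simp add: convex_INT convex_halfspace_le)
qed

text \<open>
  The segment from any point of \<open>C\<close> to a relative interior point can be prolonged a little
  beyond it inside \<open>C\<close>. A functional that had grown along the segment would keep growing on the
  prolongation, so it could not be maximal at the relative interior point.
\<close>

lemma inner_le_rel_interior_const: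
  fixes C :: "'a::euclidean_space set"
  assumes C: "convex C" and a: "a \<in> rel_interior C"
    and max: "\<And>g. g \<in> C \<Longrightarrow> g \<bullet> h \<le> a \<bullet> h" and g: "g \<in> C"
  shows "g \<bullet> h = a \<bullet> h"
proof -
  obtain m where m: "m > 1" "(1 - m) *\<^sub>R g + m *\<^sub>R a \<in> C"
    using convex_rel_interior_if2[OF C a] hull_inc[OF g] by blast
  have "((1 - m) *\<^sub>R g + m *\<^sub>R a) \<bullet> h \<le> a \<bullet> h"
    using max[OF m(2)] .
  then have "(m - 1) * (a \<bullet> h) \<le> (m - 1) * (g \<bullet> h)"
    by (simp add: inner_add_left algebra_simps)
  then have "a \<bullet> h \<le> g \<bullet> h"
    using m(1) by simp
  then show ?thesis
    using max[OF g] by simp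
qed

lemma gauge_less_1_rel_interior:
  fixes C :: "'a::euclidean_space set"
  assumes C: "convex C" and f: "f \<in> rel_interior C"
    and less: "gauge_of ((\<lambda>g. g - f) ` C) (a - f) < 1"
  shows "a \<in> rel_interior C"
proof -
  obtain t d where t: "0 < t" "t < 1" and d: "d \<in> C" and a: "a - f = t *\<^sub>R (d - f)"
    using less by (auto simp: gauge_of_def Inf_less_iff one_ereal_def)
  have "d - (1 - t) *\<^sub>R (d - f) \<in> rel_interior C"
    using rel_interior_convex_shrink[OF C f d, of "1 - t"] t by simp
  moreover have "d - (1 - t) *\<^sub>R (d - f) = f + t *\<^sub>R (d - f)"
    by (simp add: algebra_simps)
  ultimately show ?thesis
    using a by (metis add.commute diff_add_cancel)
qed

lemma subspace_subdiff_space: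
  assumes "subdifferential J x \<noteq> {}"
  shows "subspace (subdiff_space J x)"
    and "subdiff_proj J x \<in> subdiff_affine J x"
proof -
  show e: "subdiff_proj J x \<in> subdiff_affine J x"
    unfolding subdiff_proj_def subdiff_affine_def
    using assms by (intro closest_point_in_set) auto
  then show "subspace (subdiff_space J x)"
    unfolding subdiff_space_def subdiff_affine_def
    by (intro affine_diffs_subspace_subtract) auto
qed

text \<open>
  The obtuse-angle inequality of the projection, applied to a direction of the affine hull and to
  its negative, turns into orthogonality.
\<close>

lemma subdiff_proj_in_model_space:
  assumes "subdifferential J x \<noteq> {}"
  shows "subdiff_proj J x \<in> model_space J x"
proof -
  have "v \<bullet> subdiff_proj J x = 0" if v: "v \<in> subdiff_space J x" for v
  proof -
    let ?e = "subdiff_proj J x"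
    have le: "- (?e \<bullet> w) \<le> 0" if w: "w \<in> subdiff_space J x" for w
    proof -
      obtain u where u: "u \<in> subdiff_affine J x" "w = u - ?e"
        using w by (auto simp: subdiff_space_def)
      have "(0 - ?e) \<bullet> (u - ?e) \<le> 0"
        using u unfolding subdiff_proj_def subdiff_affine_def
        by (intro closest_point_dot) (auto intro: affine_imp_convex)
      then show ?thesis using u by simp
    qed
    have "- v \<in> subdiff_space J x"
      using subspace_neg[OF subspace_subdiff_space(1)[OF assms] v] .
    from le[OF v] le[OF this] show ?thesis by (simp add: inner_commute)
  qed
  then show ?thesis
    by (simp add: model_space_def orthogonal_comp_def orthogonal_def)
qed

lemma closest_point_add_orthogonal_comp:
  fixes V :: "'a::euclidean_space set"
  assumes V: "subspace V"
  shows "closest_point V x + closest_point (V\<^sup>\<bottom>) x = x"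
proof -
  have "closest_point (V\<^sup>\<bottom>) ((x - closest_point V x) + closest_point V x) = x - closest_point V x"
    using closest_point_subspace[OF V]
    by (intro closest_point_decomp subspace_orthogonal_comp)
       (auto simp: orthogonal_comp_def orthogonal_def inner_commute)
  then show ?thesis by simp
qed

lemma transpose_restr_matrix_works:
  assumes "subspace V"
  shows "transpose (restr_matrix \<Phi> V) *v q = closest_point V (transpose \<Phi> *v q)"
  by (simp only: restr_matrix_def matrix_transpose_mul transpose_proj_matrix[OF assms]
      proj_matrix_works[OF assms] flip: matrix_vector_mul_assoc)

text \<open>
  For \<open>A = \<Phi> P\<^sub>T\<close> the matrix \<open>A\<^sup>+ A\<close> is symmetric, so \<open>A\<^sup>T (A\<^sup>+)\<^sup>T = A\<^sup>+ A\<close>, and its range lies in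
  that of \<open>A\<^sup>T\<close>, hence in \<open>T\<close>. As \<open>\<Phi>\<close> is injective on \<open>T\<close>, the identity \<open>A A\<^sup>+ A = A\<close> then
  forces \<open>A\<^sup>+ A\<close> to fix \<open>T\<close> pointwise.
\<close>

lemma transpose_restr_pinv:
  fixes \<Phi> :: "real^'n^'q"
  assumes T: "subspace T" and ker: "{v. \<Phi> *v v = 0} \<inter> T = {0}" and e: "e \<in> T"
  defines "A \<equiv> restr_matrix \<Phi> T"
  shows "transpose A *v (transpose (pinv A) *v e) = e"
proof -
  have "is_pinv A (pinv A)"
    unfolding pinv_def using ex1_is_pinv by (rule theI')
  then have AXA: "A ** pinv A ** A = A" and sym: "transpose (pinv A ** A) = pinv A ** A"
    by (auto simp: is_pinv_def)
  define w where "w = transpose A *v (transpose (pinv A) *v e)"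
  have w: "w = pinv A *v (A *v e)"
    using sym unfolding w_def matrix_vector_mul_assoc by (simp only: matrix_transpose_mul)
  have A: "A *v v = \<Phi> *v v" if "v \<in> T" for v
    using that T by (simp add: A_def restr_matrix_def proj_matrix_works closest_point_self
        flip: matrix_vector_mul_assoc)
  have "w \<in> T"
    unfolding w_def A_def transpose_restr_matrix_works[OF T]
    by (rule closest_point_subspace(1)[OF T])
  then have wT: "w - e \<in> T"
    using T e by (simp add: subspace_diff)
  have "A *v w = A *v e"
    using AXA by (simp add: w matrix_vector_mul_assoc matrix_mul_assoc)
  then have "\<Phi> *v (w - e) = 0"
    using A[OF wT] by (simp add: matrix_vector_mult_diff_distrib)
  with wT have "w - e \<in> {v. \<Phi> *v v = 0} \<inter> T"
    by simp
  then have "w = e"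
    unfolding ker by simp
  then show ?thesis by (simp add: w_def)
qed

lemma dual_certificate:
  fixes \<Phi> :: "real^'n^'q"
  assumes f: "f \<in> rel_interior (subdifferential J x0)"
    and ker: "{v. \<Phi> *v v = 0} \<inter> model_space J x0 = {0}"
    and IC: "IC \<Phi> J x0 f < 1"
  obtains q where "transpose \<Phi> *v q \<in> rel_interior (subdifferential J x0)"
proof
  let ?S = "subdiff_space J x0" and ?T = "model_space J x0" and ?e = "subdiff_proj J x0"
  let ?q = "transpose (pinv (restr_matrix \<Phi> ?T)) *v ?e"
  let ?a = "transpose \<Phi> *v ?q"
  have fD: "f \<in> subdifferential J x0"
    using f rel_interior_subset by blast
  then have ne: "subdifferential J x0 \<noteq> {}" by auto
  note S = subspace_subdiff_space(1)[OF ne]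
  have T: "subspace ?T"
    by (simp add: model_space_def subspace_orthogonal_comp)
  note e = subdiff_proj_in_model_space[OF ne]
  have "closest_point ?T ?a = ?e"
    using transpose_restr_pinv[OF T ker e] by (simp only: transpose_restr_matrix_works[OF T])
  then have a: "closest_point ?S ?a = ?a - ?e"
    using closest_point_add_orthogonal_comp[OF S, of ?a] by (simp add: model_space_def algebra_simps)
  have "f - ?e \<in> ?S"
    using fD hull_inc by (fastforce simp: subdiff_space_def subdiff_affine_def)
  then have "closest_point ?S ((f - ?e) + ?e) = f - ?e"
    using e by (intro closest_point_decomp S)
      (auto simp: model_space_def orthogonal_comp_def orthogonal_def)
  then have "closest_point ?S f = f - ?e" by simp
  then have "gauge_of ((\<lambda>g. g - f) ` subdifferential J x0) (?a - f) < 1"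
    using IC by (simp add: IC_def subdiff_gauge_def transpose_restr_matrix_works[OF S]
        proj_matrix_works[OF S] a del: transpose_matrix_vector)
  then show "?a \<in> rel_interior (subdifferential J x0)"
    by (rule gauge_less_1_rel_interior[OF convex_subdifferential f])
qed

text \<open>
  A functional that is constant on the subdifferential is constant on its affine hull, which is
  a translate of the direction space; so the descent directions orthogonal to a relative interior
  subgradient lie in the model subspace.
\<close>

lemma descent_in_model_space:
  fixes J :: "'a::euclidean_space \<Rightarrow> real"
  assumes a: "a \<in> rel_interior (subdifferential J x0)"
    and orth: "a \<bullet> (x - x0) = 0" and le: "J x \<le> J x0"
  shows "x - x0 \<in> model_space J x0"
proof -
  let ?D = "subdifferential J x0"
  have max: "g \<bullet> (x - x0) \<le> a \<bullet> (x - x0)" if "g \<in> ?D" for g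
  proof -
    have "J x0 + g \<bullet> (x - x0) \<le> J x"
      using that by (simp add: subdifferential_def)
    then show ?thesis using le orth by linarith
  qed
  have "?D \<subseteq> {g. (x - x0) \<bullet> g = 0}"
    using inner_le_rel_interior_const[OF convex_subdifferential a max] orth
    by (auto simp: inner_commute[of "x - x0"])
  then have hull: "subdiff_affine J x0 \<subseteq> {g. (x - x0) \<bullet> g = 0}"
    unfolding subdiff_affine_def by (intro hull_minimal affine_hyperplane)
  have "?D \<noteq> {}" using a rel_interior_subset by blast
  note e = subspace_subdiff_space(2)[OF this]
  have "v \<bullet> (x - x0) = 0" if v: "v \<in> subdiff_space J x0" for v
  proof -
    obtain u where u: "u \<in> subdiff_affine J x0" "v = u - subdiff_proj J x0"
      using v by (auto simp: subdiff_space_def)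
    have "(x - x0) \<bullet> u = 0" "(x - x0) \<bullet> subdiff_proj J x0 = 0"
      using hull e u(1) by blast+
    then show ?thesis
      unfolding u(2) by (metis diff_zero inner_commute inner_diff_right)
  qed
  then show ?thesis
    by (simp add: model_space_def orthogonal_comp_def orthogonal_def)
qed

theorem theorem5:
  fixes \<Phi> :: "real^'n^'q" and J :: "real^'n \<Rightarrow> real"
    and x0 f :: "real^'n" and y :: "real^'q"
  assumes "convex_on UNIV J"
    and "f \<in> rel_interior (subdifferential J x0)"
    and "y = \<Phi> *v x0"
    and "{v. \<Phi> *v v = 0} \<inter> model_space J x0 = {0}"
    and "IC \<Phi> J x0 f < 1"
  shows "{x. is_arg_min J (\<lambda>x. \<Phi> *v x = y) x} = {x0}"
proof -
  obtain q where q: "transpose \<Phi> *v q \<in> rel_interior (subdifferential J x0)"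
    using dual_certificate[OF assms(2,4,5)] .
  have unique: "x = x0" if x: "\<Phi> *v x = y" and le: "J x \<le> J x0" for x
  proof -
    have ker: "\<Phi> *v (x - x0) = 0"
      using x assms(3) by (simp add: matrix_vector_mult_diff_distrib)
    then have "(transpose \<Phi> *v q) \<bullet> (x - x0) = 0"
      by (simp add: transpose_matrix_vector dot_lmul_matrix)
    then have "x - x0 \<in> model_space J x0"
      by (rule descent_in_model_space[OF q _ le])
    with ker have "x - x0 \<in> {v. \<Phi> *v v = 0} \<inter> model_space J x0"
      by simp
    then show ?thesis
      unfolding assms(4) by simp
  qed
  have "J x0 < J x" if "\<Phi> *v x = y" "x \<noteq> x0" for x
    using unique[of x] that by (meson not_le)
  then have "is_arg_min J (\<lambda>x. \<Phi> *v x = y) x \<longleftrightarrow> x = x0" for x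
    using assms(3) unfolding is_arg_min_def by (metis less_asym)
  then show ?thesis by simp
qed

end
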